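(* There exists a Banach space with an unconditional basis that is not almost greedy with constant $1$ but is $\lambda$-almost greedy with constant $1$ for some $\lambda>1$.
   Context: Let $(X,\|\cdot\|)$ be an infinite-dimensional Banach space over $\mathbb{K}=\mathbb{R}$ or $\mathbb{C}$ with dual $(X^*,\|\cdot\|_* )$. A basis of $X$ is a sequence $\mathcal{B}=(e_n)_{n=1}^\infty$ in $X$ such that: (1) there is a unique sequence $(e_n^* )_{n=1}^\infty$ in $X^*$ with $e_i^*(e_j)=\delta_{i,j}$ for all $i,j$; (2) $\sup_n\|e_n\|\|e_n^*\|_*<\infty$ and $0<\inf_n\|e_n\|\leqslant\sup_n\|e_n\|<\infty$; (3) $X$ is the norm-closed linear span of $\{e_n\}$; (4) $X^*$ is the weak$^*$-closed linear span of $\{e_n^*\}$. Notation: $\mathbb{N}_0=\mathbb{N}\cup\{0\}$. For $A\subset\mathbb{N}$, $P_A(x)=\sum_{n\in A}e_n^*(x)e_n$ (for infinite $A$, the series is required to converge). A finite set $\Lambda\subset\mathbb{N}$ is a greedy set of $x\in X$ if $\min_{n\in\Lambda}|e_n^*(x)|\geqslant\max_{n\notin\Lambda}|e_n^*(x)|$ (the empty set is a greedy set of every $x$). For $m\in\mathbb{N}_0$, $\gamma_m(x)=\sup\{\|x-P_\Lambda(x)\|:\Lambda\text{ is a greedy set of }x,\ |\Lambda|=m\}$ and $\widetilde{\sigma}_m(x)=\inf\{\|x-P_A(x)\|:A\subset\mathbb{N},|A|=m\}$. $\mathcal{B}$ is unconditional if there is $C\geqslant 1$ with $\|P_A(x)\|\leqslant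 C\|x\|$ for all $x\in X$ and $A\subset\mathbb{N}$. $\mathcal{B}$ is almost greedy with constant $C$ if $\gamma_m(x)\leqslant C\widetilde{\sigma}_m(x)$ for all $x\in X$, $m\in\mathbb{N}_0$. $\mathcal{B}$ is $\lambda$-almost greedy with constant $C$ if $\gamma_{\lceil\lambda m\rceil}(x)\leqslant C\widetilde{\sigma}_m(x)$ for all $x\in X$, $m\in\mathbb{N}_0$. *)

theory Defs
  imports "HOL-Analysis.Analysis" "HOL-Library.Function_Algebras"
begin

text \<open>
  Banach spaces are quantified existentially below, so they are given by an explicit carrier
  \<open>V\<close>, a linear subspace of an ambient vector space over the scalars \<open>'k\<close> (instantiated with
  \<open>real\<close> and \<open>complex\<close>), and a norm on \<open>V\<close>. Nothing is assumed about \<open>nrm\<close> outside \<open>V\<close>.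
\<close>

locale normed_space_on = vector_space scale
  for scale :: "'k::real_normed_field \<Rightarrow> 'a::ab_group_add \<Rightarrow> 'a" +
  fixes V :: "'a set" and nrm :: "'a \<Rightarrow> real"
  assumes subspace_V: "subspace V"
    and nrm_nonneg: "x \<in> V \<Longrightarrow> 0 \<le> nrm x"
    and nrm_eq_0_iff: "x \<in> V \<Longrightarrow> nrm x = 0 \<longleftrightarrow> x = 0"
    and nrm_triangle: "x \<in> V \<Longrightarrow> y \<in> V \<Longrightarrow> nrm (x + y) \<le> nrm x + nrm y"
    and nrm_scale: "x \<in> V \<Longrightarrow> nrm (scale c x) = norm c * nrm x"
begin

text \<open>The guard is needed because \<^locale>\<open>Metric_space\<close> demands nonnegativity and symmetry
  of the distance also outside the carrier.\<close>

definition dst :: "'a \<Rightarrow> 'a \<Rightarrow> real" where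
  "dst x y = (if x \<in> V \<and> y \<in> V then nrm (x - y) else 0)"

lemma nrm_minus_commute:
  assumes "x \<in> V" "y \<in> V"
  shows "nrm (x - y) = nrm (y - x)"
proof -
  have "nrm (scale (- 1) (x - y)) = norm (- 1 :: 'k) * nrm (x - y)"
    using assms subspace_V by (intro nrm_scale) (rule subspace_diff)
  then show ?thesis by simp
qed

sublocale Metric_space V dst
proof
  show "0 \<le> dst x y" for x y
    by (simp add: dst_def nrm_nonneg subspace_V subspace_diff)
  show "dst x y = dst y x" for x y
    by (simp add: dst_def nrm_minus_commute)
  show "dst x y = 0 \<longleftrightarrow> x = y" if "x \<in> V" "y \<in> V" for x y
    using that by (simp add: dst_def nrm_eq_0_iff subspace_V subspace_diff)
  show "dst x z \<le> dst x y + dst y z" if "x \<in> V" "y \<in> V" "z \<in> V" for x y z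
  proof -
    have "nrm ((x - y) + (y - z)) \<le> nrm (x - y) + nrm (y - z)"
      using that subspace_V by (intro nrm_triangle) (auto intro: subspace_diff)
    then show ?thesis using that by (simp add: dst_def)
  qed
qed

definition infinite_dimensional :: bool where
  "infinite_dimensional \<longleftrightarrow> \<not> (\<exists>S. finite S \<and> span S = V)"

text \<open>Functionals are taken to be \<^const>\<open>undefined\<close> outside \<open>V\<close>, so that two
  functionals are equal iff they agree on \<open>V\<close>.\<close>

definition dual :: "('a \<Rightarrow> 'k) set" where
  "dual = {f \<in> extensional V.
     (\<forall>x\<in>V. \<forall>y\<in>V. f (x + y) = f x + f y) \<and>
     (\<forall>c. \<forall>x\<in>V. f (scale c x) = c * f x) \<and>
     (\<exists>B. \<forall>x\<in>V. norm (f x) \<le> B * nrm x)}"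

definition dual_norm :: "('a \<Rightarrow> 'k) \<Rightarrow> real" where
  "dual_norm f = Sup ((\<lambda>x. norm (f x)) ` {x \<in> V. nrm x \<le> 1})"

definition dual_span :: "('a \<Rightarrow> 'k) set \<Rightarrow> ('a \<Rightarrow> 'k) set" where
  "dual_span F = {restrict (\<lambda>x. \<Sum>f\<in>G. c f * f x) V | G c. finite G \<and> G \<subseteq> F}"

definition weak_star_topology :: "('a \<Rightarrow> 'k) topology" where
  "weak_star_topology = subtopology (product_topology (\<lambda>_. euclidean) V) dual"

definition biorthogonal :: "(nat \<Rightarrow> 'a) \<Rightarrow> (nat \<Rightarrow> 'a \<Rightarrow> 'k) \<Rightarrow> bool" where
  "biorthogonal e es \<longleftrightarrow>
     (\<forall>n. es n \<in> dual) \<and> (\<forall>i j. es i (e j) = (if i = j then 1 else 0))"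

definition coord :: "(nat \<Rightarrow> 'a) \<Rightarrow> nat \<Rightarrow> 'a \<Rightarrow> 'k" where
  "coord e = (THE es. biorthogonal e es)"

text \<open>Basis vectors are indexed from \<open>0\<close>.\<close>

definition basis :: "(nat \<Rightarrow> 'a) \<Rightarrow> bool" where
  "basis e \<longleftrightarrow>
     range e \<subseteq> V \<and>
     (\<exists>!es. biorthogonal e es) \<and>
     bdd_above (range (\<lambda>n. nrm (e n) * dual_norm (coord e n))) \<and>
     0 < (INF n. nrm (e n)) \<and> bdd_above (range (\<lambda>n. nrm (e n))) \<and>
     mtopology closure_of span (range e) = V \<and>
     weak_star_topology closure_of dual_span (range (coord e)) = dual"

definition partial_proj :: "(nat \<Rightarrow> 'a) \<Rightarrow> nat set \<Rightarrow> 'a \<Rightarrow> nat \<Rightarrow> 'a" where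
  "partial_proj e A x N = (\<Sum>n\<in>A \<inter> {..<N}. scale (coord e n x) (e n))"

definition proj_converges :: "(nat \<Rightarrow> 'a) \<Rightarrow> nat set \<Rightarrow> 'a \<Rightarrow> bool" where
  "proj_converges e A x \<longleftrightarrow> (\<exists>y. limitin mtopology (partial_proj e A x) y sequentially)"

definition proj :: "(nat \<Rightarrow> 'a) \<Rightarrow> nat set \<Rightarrow> 'a \<Rightarrow> 'a" where
  "proj e A x =
     (if finite A then \<Sum>n\<in>A. scale (coord e n x) (e n)
      else THE y. limitin mtopology (partial_proj e A x) y sequentially)"

definition unconditional :: "(nat \<Rightarrow> 'a) \<Rightarrow> bool" where
  "unconditional e \<longleftrightarrow>
     (\<exists>C\<ge>1. \<forall>x\<in>V. \<forall>A. proj_converges e A x \<and> nrm (proj e A x) \<le> C * nrm x)"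

definition greedy_set :: "(nat \<Rightarrow> 'a) \<Rightarrow> 'a \<Rightarrow> nat set \<Rightarrow> bool" where
  "greedy_set e x \<Lambda> \<longleftrightarrow>
     finite \<Lambda> \<and> (\<forall>n\<in>\<Lambda>. \<forall>k. k \<notin> \<Lambda> \<longrightarrow> norm (coord e k x) \<le> norm (coord e n x))"

definition greedy_error :: "(nat \<Rightarrow> 'a) \<Rightarrow> nat \<Rightarrow> 'a \<Rightarrow> real" where
  "greedy_error e m x = Sup {nrm (x - proj e \<Lambda> x) | \<Lambda>. greedy_set e x \<Lambda> \<and> card \<Lambda> = m}"

definition projection_error :: "(nat \<Rightarrow> 'a) \<Rightarrow> nat \<Rightarrow> 'a \<Rightarrow> real" where
  "projection_error e m x = Inf {nrm (x - proj e A x) | A. finite A \<and> card A = m}"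

definition almost_greedy :: "(nat \<Rightarrow> 'a) \<Rightarrow> real \<Rightarrow> bool" where
  "almost_greedy e C \<longleftrightarrow> (\<forall>x\<in>V. \<forall>m. greedy_error e m x \<le> C * projection_error e m x)"

definition lambda_almost_greedy :: "real \<Rightarrow> (nat \<Rightarrow> 'a) \<Rightarrow> real \<Rightarrow> bool" where
  "lambda_almost_greedy lam e C \<longleftrightarrow>
     (\<forall>x\<in>V. \<forall>m. greedy_error e (nat \<lceil>lam * real m\<rceil>) x \<le> C * projection_error e m x)"

end

locale banach_space_on = normed_space_on +
  assumes complete: mcomplete

text \<open>
  The ambient space \<open>nat \<Rightarrow> 'k\<close> with pointwise operations is large enough to host, up to isometric
  isomorphism, every Banach space with a basis: \<open>x \<mapsto> (\<lambda>n. coord e n x)\<close> is linear and injective,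
  since the coordinate functionals of a basis separate points.
\<close>

end

theory Submission
  imports Defs
begin

text \<open>
  A weighted \<open>\<ell>\<^sub>1\<close> space already separates the two properties. Take the norm
  \<open>\<parallel>x\<parallel> = (\<Sum>n. w n * \<bar>x n\<bar>)\<close> with weights \<open>1 \<le> w n \<le> L\<close>. The unit vectors form a basis, and since
  deleting coordinates never increases the norm, this basis is unconditional.

  Removing a finite set \<open>S\<close> of coordinates lowers the norm by exactly \<open>\<Sum>n\<in>S. w n * \<bar>x n\<bar>\<close>. So comparing
  a greedy set \<open>\<Lambda>\<close> with a competitor \<open>A\<close> amounts to comparing these two sums, and the common part
  \<open>A \<inter> \<Lambda>\<close> cancels. If \<open>t\<close> is the largest modulus of a coefficient on \<open>A - \<Lambda>\<close>, then each term over
  \<open>A - \<Lambda>\<close> is at most \<open>L * t\<close>, whereas each term over \<open>\<Lambda> - A\<close> is at least \<open>t\<close>. Hence \<open>\<Lambda>\<close> wins as soon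
  as \<open>\<Lambda> - A\<close> has at least \<open>L\<close> times as many elements as \<open>A - \<Lambda>\<close>, which follows from
  \<open>card \<Lambda> \<ge> L * card A\<close> (lemma \<open>greedy_residual_le\<close>). This is \<open>L\<close>-almost greediness with constant 1.

  Almost greediness with constant 1 itself fails once two weights differ, say \<open>w i < w j\<close>: all
  nonzero coefficients of \<open>e i + e j\<close> are equal, so \<open>{i}\<close> is a greedy set, but it is better to remove
  the heavier coordinate \<open>j\<close> (lemma \<open>not_almost_greedy\<close>).
\<close>

section \<open>Sequences and greedy sets\<close>

lemma sum_fun_apply: "(\<Sum>i\<in>S. f i) n = (\<Sum>i\<in>S. f i n)"
  by (induction S rule: infinite_finite_induct) auto

lemma limitin_imp_in_closure_of:
  assumes "limitin X f l F" "eventually (\<lambda>a. f a \<in> S) F" "F \<noteq> bot"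
  shows "l \<in> X closure_of S"
  unfolding in_closure_of
proof (intro conjI allI impI)
  show "l \<in> topspace X"
    using assms(1) by (simp add: limitin_def)
  fix T assume "l \<in> T \<and> openin X T"
  then have "eventually (\<lambda>a. f a \<in> T) F"
    using assms(1) by (simp add: limitin_def)
  with assms(2) have "eventually (\<lambda>a. f a \<in> S \<and> f a \<in> T) F"
    by eventually_elim simp
  then show "\<exists>y. y \<in> S \<and> y \<in> T"
    using assms(3) eventually_happens by blast
qed

text \<open>
  A null sequence attains its largest modulus on the complement of any finite set, so greedy sets
  can be enlarged one element at a time.
\<close>

lemma null_sequence_greedy_exists:
  fixes x :: "nat \<Rightarrow> 'b::real_normed_vector"
  assumes "x \<longlonglongrightarrow> 0"
  shows "\<exists>\<Lambda>. finite \<Lambda> \<and> card \<Lambda> = m \<and> (\<forall>n\<in>\<Lambda>. \<forall>k. k \<notin> \<Lambda> \<longrightarrow> norm (x k) \<le> norm (x n))"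
proof (induction m)
  case 0
  show ?case by (intro exI[of _ "{}"]) simp
next
  case (Suc m)
  then obtain \<Lambda> where L: "finite \<Lambda>" "card \<Lambda> = m"
    "\<And>n k. n \<in> \<Lambda> \<Longrightarrow> k \<notin> \<Lambda> \<Longrightarrow> norm (x k) \<le> norm (x n)"
    by blast
  obtain k where k: "k \<notin> \<Lambda>" "\<And>j. j \<notin> \<Lambda> \<Longrightarrow> norm (x j) \<le> norm (x k)"
  proof (cases "\<exists>k. k \<notin> \<Lambda> \<and> x k \<noteq> 0")
    case True
    then obtain a where a: "a \<notin> \<Lambda>" "x a \<noteq> 0" by blast
    define S where "S = {n. n \<notin> \<Lambda> \<and> norm (x a) \<le> norm (x n)}"
    have "eventually (\<lambda>n. norm (x n) < norm (x a)) sequentially"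
      using tendstoD[OF assms, of "norm (x a)"] a by simp
    then obtain N where N: "\<And>n. n \<ge> N \<Longrightarrow> norm (x n) < norm (x a)"
      by (auto simp: eventually_sequentially)
    have "S \<subseteq> {..<N}"
      using N by (auto simp: S_def simp flip: not_le)
    then have "finite S" using finite_subset by blast
    moreover have "a \<in> S" using a by (simp add: S_def)
    ultimately obtain b where b: "b \<in> S" "\<And>n. n \<in> S \<Longrightarrow> norm (x n) \<le> norm (x b)"
      using obtains_MAX[of S "\<lambda>n. norm (x n)"] by (metis Max_ge empty_iff finite_imageI imageI)
    show thesis
    proof (rule that)
      show "b \<notin> \<Lambda>" using b by (simp add: S_def)
      show "norm (x j) \<le> norm (x b)" if "j \<notin> \<Lambda>" for j
        using b that \<open>a \<in> S\<close> by (cases "j \<in> S") (force simp: S_def)+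
    qed
  next
    case False
    obtain k where "k \<notin> \<Lambda>" using L(1) ex_new_if_finite infinite_UNIV_nat by blast
    with False show thesis by (intro that) auto
  qed
  show ?case
    by (rule exI[of _ "insert k \<Lambda>"]) (use L k in auto)
qed

section \<open>Weighted summable sequences\<close>

definition pointwise_scale :: "'k::times \<Rightarrow> (nat \<Rightarrow> 'k) \<Rightarrow> nat \<Rightarrow> 'k" where
  "pointwise_scale c x = (\<lambda>n. c * x n)"

definition unit_seq :: "nat \<Rightarrow> nat \<Rightarrow> 'k::zero_neq_one" where
  "unit_seq i = (\<lambda>n. if n = i then 1 else 0)"

definition keep :: "nat set \<Rightarrow> (nat \<Rightarrow> 'k) \<Rightarrow> nat \<Rightarrow> 'k::zero" where
  "keep A x = (\<lambda>n. if n \<in> A then x n else 0)"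

definition weighted_l1_space :: "(nat \<Rightarrow> real) \<Rightarrow> (nat \<Rightarrow> 'k::real_normed_vector) set" where
  "weighted_l1_space w = {x. summable (\<lambda>n. w n * norm (x n))}"

definition weighted_l1_norm :: "(nat \<Rightarrow> real) \<Rightarrow> (nat \<Rightarrow> 'k::real_normed_vector) \<Rightarrow> real" where
  "weighted_l1_norm w x = (\<Sum>n. w n * norm (x n))"

lemma vector_space_pointwise: "vector_space (pointwise_scale :: 'k::field \<Rightarrow> _)"
  by unfold_locales (auto simp: pointwise_scale_def fun_eq_iff algebra_simps)

text \<open>
  The argument \<open>scalars\<close> only ties the type of scalars to the locale, so that the normed space below
  is determined by the parameters.
\<close>

locale weighted_l1 =
  fixes w :: "nat \<Rightarrow> real" and L :: real and scalars :: "'k::{real_normed_field,banach} itself"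
  assumes weight_ge_1: "1 \<le> w n" and weight_le: "w n \<le> L"
begin

abbreviation V :: "(nat \<Rightarrow> 'k) set" where "V \<equiv> weighted_l1_space w"
abbreviation nrm :: "(nat \<Rightarrow> 'k) \<Rightarrow> real" where "nrm \<equiv> weighted_l1_norm w"
abbreviation e :: "nat \<Rightarrow> nat \<Rightarrow> 'k" where "e \<equiv> unit_seq"

lemma weight_pos [simp]: "0 < w n" "0 \<le> w n"
  using weight_ge_1[of n] by auto

lemma L_ge_1: "1 \<le> L"
  using weight_ge_1 weight_le order_trans by blast

lemma V_iff: "x \<in> V \<longleftrightarrow> summable (\<lambda>n. w n * norm (x n))"
  by (simp add: weighted_l1_space_def)

lemma V_of_dominated:
  assumes "x \<in> V" "\<And>n. norm (y n :: 'k) \<le> norm (x n)"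
  shows "y \<in> V" "nrm y \<le> nrm x"
proof -
  have s: "summable (\<lambda>n. w n * norm (x n))" using assms V_iff by simp
  have le: "w n * norm (y n) \<le> w n * norm (x n)" for n
    using assms by (intro mult_left_mono) auto
  have s': "summable (\<lambda>n. w n * norm (y n))"
    by (rule summable_comparison_test[OF _ s]) (use le in \<open>auto intro!: exI[of _ 0]\<close>)
  then show "y \<in> V" by (simp add: V_iff)
  show "nrm y \<le> nrm x"
    unfolding weighted_l1_norm_def by (intro suminf_le le s s')
qed

lemma nrm_finite_support:
  assumes "finite S" "\<And>n. n \<notin> S \<Longrightarrow> (x n :: 'k) = 0"
  shows "x \<in> V" "nrm x = (\<Sum>n\<in>S. w n * norm (x n))"
proof -
  have "(\<lambda>n. w n * norm (x n)) sums (\<Sum>n\<in>S. w n * norm (x n))"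
    using assms by (intro sums_finite) auto
  then show "x \<in> V" "nrm x = (\<Sum>n\<in>S. w n * norm (x n))"
    by (auto simp: V_iff weighted_l1_norm_def sums_iff)
qed

lemma e_in_V: "e i \<in> V" and nrm_e: "nrm (e i) = w i"
  using nrm_finite_support[of "{i}" "e i"] by (auto simp: unit_seq_def)

lemma nrm_nonneg': "x \<in> V \<Longrightarrow> 0 \<le> nrm x"
  unfolding weighted_l1_norm_def by (intro suminf_nonneg) (auto simp: V_iff)

lemma weighted_coefficient_le_nrm:
  assumes "x \<in> V" shows "w n * norm (x n) \<le> nrm x"
proof -
  have "sum (\<lambda>n. w n * norm (x n)) {n} \<le> nrm x"
    unfolding weighted_l1_norm_def using assms by (intro sum_le_suminf) (auto simp: V_iff)
  then show ?thesis by simp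
qed

lemma coefficient_le_nrm:
  assumes "x \<in> V" shows "norm (x n) \<le> nrm x"
proof -
  have "1 * norm (x n) \<le> w n * norm (x n)"
    by (intro mult_right_mono weight_ge_1) simp
  then show ?thesis using weighted_coefficient_le_nrm[OF assms, of n] by simp
qed

lemma null_sequence:
  assumes "x \<in> V" shows "x \<longlonglongrightarrow> 0"
proof -
  have "summable (\<lambda>n. norm (x n))"
  proof (rule summable_comparison_test)
    have "norm (x n) \<le> w n * norm (x n)" for n
      using mult_right_mono[OF weight_ge_1, of "norm (x n)" n] by simp
    then show "\<exists>N. \<forall>n\<ge>N. norm (norm (x n)) \<le> w n * norm (x n)" by auto
    show "summable (\<lambda>n. w n * norm (x n))" using assms V_iff by simp
  qed
  then show ?thesis
    using summable_LIMSEQ_zero tendsto_norm_zero_cancel by blast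
qed

lemma triangle:
  assumes "x \<in> V" "y \<in> V"
  shows "x + y \<in> V" "nrm (x + y) \<le> nrm x + nrm y"
proof -
  have s: "summable (\<lambda>n. w n * norm (x n) + w n * norm (y n))"
    using assms by (simp add: V_iff summable_add)
  have le: "w n * norm ((x + y) n) \<le> w n * norm (x n) + w n * norm (y n)" for n
    unfolding distrib_left[symmetric] by (intro mult_left_mono) (auto simp: norm_triangle_ineq)
  have s': "summable (\<lambda>n. w n * norm ((x + y) n))"
    by (rule summable_comparison_test[OF _ s]) (use le in \<open>auto intro!: exI[of _ 0]\<close>)
  then show "x + y \<in> V" by (simp add: V_iff)
  have "nrm (x + y) \<le> (\<Sum>n. w n * norm (x n) + w n * norm (y n))"
    unfolding weighted_l1_norm_def by (intro suminf_le le s s')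
  also have "\<dots> = nrm x + nrm y"
    unfolding weighted_l1_norm_def using assms
    by (intro suminf_add[symmetric]) (auto simp: V_iff)
  finally show "nrm (x + y) \<le> nrm x + nrm y" .
qed

lemma scaling:
  assumes "x \<in> V"
  shows "pointwise_scale c x \<in> V" "nrm (pointwise_scale c x) = norm c * nrm x"
proof -
  have "(\<lambda>n. norm c * (w n * norm (x n))) sums (norm c * nrm x)"
    using assms unfolding V_iff weighted_l1_norm_def by (intro sums_mult) (rule summable_sums)
  moreover have "(\<lambda>n. norm c * (w n * norm (x n))) = (\<lambda>n. w n * norm (pointwise_scale c x n))"
    by (simp add: pointwise_scale_def norm_mult fun_eq_iff)
  ultimately show "pointwise_scale c x \<in> V" "nrm (pointwise_scale c x) = norm c * nrm x"
    by (auto simp: V_iff weighted_l1_norm_def sums_iff)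
qed

lemma zero_in_V: "0 \<in> V"
  using nrm_finite_support[of "{}" 0] by simp

end

sublocale weighted_l1 \<subseteq> normed_space_on
  "pointwise_scale :: 'k \<Rightarrow> (nat \<Rightarrow> 'k) \<Rightarrow> nat \<Rightarrow> 'k" V nrm
proof (intro normed_space_on.intro normed_space_on_axioms.intro vector_space_pointwise)
  interpret vector_space "pointwise_scale :: 'k \<Rightarrow> (nat \<Rightarrow> 'k) \<Rightarrow> nat \<Rightarrow> 'k"
    by (rule vector_space_pointwise)
  show "subspace V"
    by (intro subspaceI zero_in_V triangle scaling)
  show "nrm x = 0 \<longleftrightarrow> x = 0" if "x \<in> V" for x
  proof
    assume "nrm x = 0"
    then have "norm (x n) \<le> 0" for n
      using coefficient_le_nrm[OF that, of n] by simp
    then show "x = 0" by (simp add: fun_eq_iff)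
  qed (simp add: weighted_l1_norm_def)
qed (auto intro: nrm_nonneg' triangle scaling)

context weighted_l1
begin

lemma diff_in_V: "x \<in> V \<Longrightarrow> y \<in> V \<Longrightarrow> x - y \<in> V"
  using subspace_diff[OF subspace_V] .

lemma keep_in_V: "x \<in> V \<Longrightarrow> keep A x \<in> V" and nrm_keep_le: "x \<in> V \<Longrightarrow> nrm (keep A x) \<le> nrm x"
  using V_of_dominated[of x "keep A x"] by (auto simp: keep_def)

lemma nrm_keep_compl:
  assumes "x \<in> V" "finite S"
  shows "nrm (x - keep S x) = nrm x - (\<Sum>n\<in>S. w n * norm (x n))"
proof -
  have "(\<lambda>n. if n \<in> S then w n * norm (x n) else 0) sums (\<Sum>n\<in>S. w n * norm (x n))"
    using assms(2) by (rule sums_If_finite_set)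
  moreover have "(\<lambda>n. w n * norm (x n)) sums nrm x"
    using assms(1) by (simp add: V_iff weighted_l1_norm_def summable_sums)
  ultimately have "(\<lambda>n. w n * norm (x n) - (if n \<in> S then w n * norm (x n) else 0))
      sums (nrm x - (\<Sum>n\<in>S. w n * norm (x n)))"
    by (intro sums_diff)
  moreover have "(\<lambda>n. w n * norm (x n) - (if n \<in> S then w n * norm (x n) else 0))
      = (\<lambda>n. w n * norm ((x - keep S x) n))"
    by (auto simp: keep_def fun_eq_iff)
  ultimately show ?thesis
    by (simp add: weighted_l1_norm_def sums_iff)
qed

text \<open>
  A norm-Cauchy sequence is Cauchy in each coordinate. Its coordinatewise limit is the norm limit,
  because a bound on all finite sections of the weighted sum survives the passage to the limit.
\<close>

lemma complete_V: mcomplete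
  unfolding mcomplete_def
proof (intro allI impI)
  fix s assume "MCauchy s"
  then have sV: "s k \<in> V" for k
    by (auto simp: MCauchy_def)
  have cau: "\<exists>N. \<forall>k\<ge>N. \<forall>l\<ge>N. nrm (s k - s l) < \<epsilon>" if "0 < \<epsilon>" for \<epsilon>
    using \<open>MCauchy s\<close> that unfolding MCauchy_def dst_def by (simp add: sV)
  have "Cauchy (\<lambda>k. s k n)" for n
    unfolding Cauchy_def
  proof (intro allI impI)
    fix \<epsilon> :: real assume "0 < \<epsilon>"
    from cau[OF this] obtain N where N: "\<And>k l. k \<ge> N \<Longrightarrow> l \<ge> N \<Longrightarrow> nrm (s k - s l) < \<epsilon>"
      by blast
    have "dist (s k n) (s l n) < \<epsilon>" if "k \<ge> N" "l \<ge> N" for k l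
      using coefficient_le_nrm[OF diff_in_V[OF sV sV], of k l n] N[OF that]
      by (simp add: dist_norm)
    then show "\<exists>N. \<forall>k\<ge>N. \<forall>l\<ge>N. dist (s k n) (s l n) < \<epsilon>" by blast
  qed
  then have "\<exists>y. (\<lambda>k. s k n) \<longlonglongrightarrow> y" for n
    using Cauchy_convergent convergent_def by blast
  then obtain y where y: "\<And>n. (\<lambda>k. s k n) \<longlonglongrightarrow> y n" by metis
  have tail: "\<exists>N. \<forall>k\<ge>N. s k - y \<in> V \<and> nrm (s k - y) \<le> \<epsilon>" if "0 < \<epsilon>" for \<epsilon>
  proof -
    from cau[OF that] obtain N where N: "\<And>k l. k \<ge> N \<Longrightarrow> l \<ge> N \<Longrightarrow> nrm (s k - s l) < \<epsilon>"
      by blast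
    have "s k - y \<in> V \<and> nrm (s k - y) \<le> \<epsilon>" if k: "k \<ge> N" for k
    proof -
      have bound: "(\<Sum>n<m. w n * norm ((s k - y) n)) \<le> \<epsilon>" for m
      proof (rule tendsto_upperbound)
        show "(\<lambda>l. \<Sum>n<m. w n * norm ((s k - s l) n)) \<longlonglongrightarrow> (\<Sum>n<m. w n * norm ((s k - y) n))"
          using y by (auto intro!: tendsto_intros)
        have "(\<Sum>n<m. w n * norm ((s k - s l) n)) \<le> \<epsilon>" if "l \<ge> N" for l
        proof -
          have "(\<Sum>n<m. w n * norm ((s k - s l) n)) \<le> nrm (s k - s l)"
            unfolding weighted_l1_norm_def
            using diff_in_V[OF sV sV, of k l] by (intro sum_le_suminf) (auto simp: V_iff)
          with N[OF k that] show ?thesis by simp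
        qed
        then show "\<forall>\<^sub>F l in sequentially. (\<Sum>n<m. w n * norm ((s k - s l) n)) \<le> \<epsilon>"
          by (auto simp: eventually_sequentially)
      qed simp
      have "summable (\<lambda>n. w n * norm ((s k - y) n))"
        by (rule bounded_imp_summable[of _ \<epsilon>])
          (use bound[of "Suc _"] in \<open>auto simp: lessThan_Suc_atMost\<close>)
      then show ?thesis
        unfolding weighted_l1_norm_def V_iff
        using bound by (auto intro!: suminf_le_const)
    qed
    then show ?thesis by blast
  qed
  obtain N where "s N - y \<in> V" using tail[of 1] by auto
  then have yV: "y \<in> V"
    using diff_in_V[OF sV, of "s N - y" N] by simp
  have "limitin mtopology s y sequentially"
    unfolding limit_metric_sequentially
  proof (intro conjI allI impI yV)
    fix \<epsilon> :: real assume "0 < \<epsilon>"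
    then obtain N where "\<And>k. k \<ge> N \<Longrightarrow> nrm (s k - y) \<le> \<epsilon> / 2"
      using tail[of "\<epsilon> / 2"] by auto
    then show "\<exists>N. \<forall>k\<ge>N. s k \<in> V \<and> dst (s k) y < \<epsilon>"
      using sV yV \<open>0 < \<epsilon>\<close> by (intro exI[of _ N]) (fastforce simp: dst_def)
  qed
  then show "\<exists>y. limitin mtopology s y sequentially" by blast
qed

end

sublocale weighted_l1 \<subseteq> banach_space_on
  "pointwise_scale :: 'k \<Rightarrow> (nat \<Rightarrow> 'k) \<Rightarrow> nat \<Rightarrow> 'k" V nrm
  by unfold_locales (rule complete_V)

section \<open>The unit vector basis\<close>

context weighted_l1
begin

lemma limitin_keep:
  assumes "x \<in> V"
  shows "limitin mtopology (\<lambda>N. keep (A \<inter> {..<N}) x) (keep A x) sequentially"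
  unfolding limitin_metric_dist_null
proof (intro conjI)
  show "keep A x \<in> V" "\<forall>\<^sub>F N in sequentially. keep (A \<inter> {..<N}) x \<in> V"
    using assms by (auto simp: keep_in_V)
  have eq: "dst (keep (A \<inter> {..<N}) x) (keep A x)
      = nrm (keep A x) - (\<Sum>n<N. w n * norm (keep A x n))" for N
  proof -
    have "keep (A \<inter> {..<N}) x = keep {..<N} (keep A x)"
      by (auto simp: keep_def)
    then show ?thesis
      using nrm_keep_compl[OF keep_in_V[OF assms], of "{..<N}" A] assms
      by (simp add: dst_def keep_in_V nrm_minus_commute)
  qed
  have "(\<lambda>n. w n * norm (keep A x n)) sums nrm (keep A x)"
    using keep_in_V[OF assms, of A] by (simp add: V_iff weighted_l1_norm_def summable_sums)
  then have "(\<lambda>N. nrm (keep A x) - (\<Sum>n<N. w n * norm (keep A x n))) \<longlonglongrightarrow> nrm (keep A x) - nrm (keep A x)"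
    unfolding sums_def by (intro tendsto_intros)
  then show "(\<lambda>N. dst (keep (A \<inter> {..<N}) x) (keep A x)) \<longlonglongrightarrow> 0"
    by (simp add: eq)
qed

lemma sum_scale_e:
  assumes "finite A"
  shows "(\<Sum>n\<in>A. pointwise_scale (x n) (e n)) = keep A x"
proof
  fix k
  have "(\<Sum>n\<in>A. pointwise_scale (x n) (e n)) k = (\<Sum>n\<in>A. if k = n then x n else 0)"
    unfolding sum_fun_apply by (intro sum.cong) (auto simp: pointwise_scale_def unit_seq_def)
  then show "(\<Sum>n\<in>A. pointwise_scale (x n) (e n)) k = keep A x k"
    using assms by (simp add: keep_def)
qed

lemma dual_keep:
  assumes "f \<in> dual" "x \<in> V" "finite A"
  shows "f (keep A x) = (\<Sum>n\<in>A. f (e n) * x n)"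
  using assms(3)
proof induction
  case empty
  have "f (pointwise_scale 0 x) = 0 * f x"
    using assms(1,2) unfolding dual_def by blast
  moreover have "keep {} x = pointwise_scale 0 x"
    by (simp add: pointwise_scale_def keep_def)
  ultimately show ?case by (simp only: sum.empty mult_zero_left)
next
  case (insert k A)
  have "keep (insert k A) x = pointwise_scale (x k) (e k) + keep A x"
    using insert.hyps by (simp flip: sum_scale_e)
  then have "f (keep (insert k A) x) = x k * f (e k) + f (keep A x)"
    using assms(1,2) e_in_V[of k] keep_in_V[of x A] scaling(1)[OF e_in_V, of "x k" k]
    by (simp add: dual_def)
  then show ?case
    using insert by (simp add: mult.commute)
qed

text \<open>
  A bounded functional is the pointwise limit of its restrictions to the first \<open>N\<close> coordinates. This
  gives both the uniqueness of the coordinate functionals and their weak* totality.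
\<close>

lemma dual_sums:
  assumes "f \<in> dual" "x \<in> V"
  shows "(\<lambda>n. f (e n) * x n) sums f x"
  unfolding sums_def
proof (rule LIM_zero_cancel, rule tendsto_norm_zero_cancel)
  obtain B where B: "\<And>y. y \<in> V \<Longrightarrow> norm (f y) \<le> B * nrm y"
    using assms(1) unfolding dual_def by blast
  let ?k = "\<lambda>N. keep {..<N} x"
  have kV: "?k N \<in> V" for N by (rule keep_in_V[OF assms(2)])
  have "(\<Sum>n<N. f (e n) * x n) - f x = f (?k N - x)" for N
  proof -
    have "f ((?k N - x) + x) = f (?k N - x) + f x"
      using assms diff_in_V[OF kV assms(2), of N] unfolding dual_def by blast
    then show ?thesis
      using dual_keep[OF assms, of "{..<N}"] by simp
  qed
  then have "norm ((\<Sum>n<N. f (e n) * x n) - f x) \<le> B * dst (?k N) x" for N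
    using B[OF diff_in_V[OF kV assms(2)], of N] kV assms(2) by (simp add: dst_def)
  moreover have "(\<lambda>N. B * dst (?k N) x) \<longlonglongrightarrow> 0"
  proof -
    have "(\<lambda>N. dst (?k N) x) \<longlonglongrightarrow> 0"
      using limitin_keep[OF assms(2), of UNIV]
      by (simp add: limitin_metric_dist_null keep_def)
    then show ?thesis using tendsto_mult_right_zero by blast
  qed
  ultimately show "(\<lambda>N. norm ((\<Sum>n<N. f (e n) * x n) - f x)) \<longlonglongrightarrow> 0"
    by (intro Lim_null_comparison[of "\<lambda>N. norm ((\<Sum>n<N. f (e n) * x n) - f x)"]) auto
qed

definition coordinate :: "nat \<Rightarrow> (nat \<Rightarrow> 'k) \<Rightarrow> 'k" where
  "coordinate n = restrict (\<lambda>x. x n) V"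

lemma biorthogonal_coordinate: "biorthogonal e coordinate"
  unfolding biorthogonal_def
proof (intro conjI allI)
  show "coordinate n \<in> dual" for n
    unfolding dual_def
  proof (intro CollectI conjI)
    show "\<exists>B. \<forall>x\<in>V. norm (coordinate n x) \<le> B * nrm x"
      using coefficient_le_nrm by (intro exI[of _ 1]) (auto simp: coordinate_def)
  qed (auto simp: coordinate_def triangle scaling, simp add: pointwise_scale_def)
  show "coordinate i (e j) = (if i = j then 1 else 0)" for i j
    using e_in_V by (simp add: coordinate_def) (simp add: unit_seq_def)
qed

lemma biorthogonal_unique:
  assumes "biorthogonal e es" shows "es = coordinate"
proof (intro ext)
  fix i x
  have es: "es i \<in> dual" "\<And>j. es i (e j) = (if i = j then 1 else 0)"
    using assms by (auto simp: biorthogonal_def)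
  show "es i x = coordinate i x"
  proof (cases "x \<in> V")
    case True
    have "(\<lambda>n. es i (e n) * x n) sums es i x"
      using dual_sums es True by blast
    moreover have "(\<lambda>n. es i (e n) * x n) = (\<lambda>n. if n = i then x n else 0)"
      by (auto simp: es)
    ultimately have "es i x = x i"
      using sums_unique2 sums_single[of i x] by metis
    then show ?thesis using True by (simp add: coordinate_def)
  next
    case False
    have "es i \<in> extensional V"
      using es(1) by (simp add: dual_def)
    then show ?thesis
      using False by (simp add: coordinate_def extensional_def)
  qed
qed

lemma coord_eq: "coord e = coordinate"
  unfolding coord_def
  using biorthogonal_coordinate biorthogonal_unique by (rule the_equality)

lemma coord_apply [simp]: "x \<in> V \<Longrightarrow> coord e n x = x n"
  by (simp add: coord_eq coordinate_def)

lemma infinite_dimensional_V: infinite_dimensional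
proof -
  have inj: "inj e"
    by (rule injI) (metis unit_seq_def zero_neq_one)
  have "independent (range e)"
    unfolding dependent_def
  proof clarify
    fix i assume mem: "e i \<in> span (range e - {e i})"
    have "subspace {x :: nat \<Rightarrow> 'k. x i = 0}"
      by (rule subspaceI) (auto simp: pointwise_scale_def)
    moreover have "range e - {e i} \<subseteq> {x. x i = 0}"
      by (auto simp: unit_seq_def)
    ultimately have "e i \<in> {x. x i = 0}"
      using span_minimal mem by blast
    then show False by (simp add: unit_seq_def)
  qed
  then have "\<not> (finite S \<and> span S = V)" for S
    using independent_span_bound[of S "range e"] e_in_V inj
    by (auto dest: finite_imageD)
  then show ?thesis by (simp add: infinite_dimensional_def)
qed

lemma dual_norm_coord_le: "dual_norm (coord e n) \<le> 1"
  unfolding dual_norm_def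
proof (rule cSup_least)
  show "(\<lambda>x. norm (coord e n x)) ` {x \<in> V. nrm x \<le> 1} \<noteq> {}"
    using zero_in_V nrm_eq_0_iff[of 0] by auto
  show "t \<le> 1" if "t \<in> (\<lambda>x. norm (coord e n x)) ` {x \<in> V. nrm x \<le> 1}" for t
    using that coefficient_le_nrm by (auto intro: order_trans)
qed

lemma closure_span_e: "mtopology closure_of span (range e) = V"
proof (intro equalityI subsetI)
  show "x \<in> V" if "x \<in> mtopology closure_of span (range e)" for x
    using that closure_of_subset_topspace[of mtopology] by auto
  show "x \<in> mtopology closure_of span (range e)" if "x \<in> V" for x
  proof (rule limitin_imp_in_closure_of)
    show "limitin mtopology (\<lambda>N. keep (UNIV \<inter> {..<N}) x) x sequentially"
      using limitin_keep[OF that, of UNIV] by (simp add: keep_def)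
    have "(\<Sum>n\<in>UNIV \<inter> {..<N}. pointwise_scale (x n) (e n)) \<in> span (range e)" for N
      by (intro span_sum span_scale span_base rangeI)
    then have "keep (UNIV \<inter> {..<N}) x \<in> span (range e)" for N
      by (simp add: sum_scale_e)
    then show "\<forall>\<^sub>F N in sequentially. keep (UNIV \<inter> {..<N}) x \<in> span (range e)"
      by simp
  qed simp
qed

lemma weak_star_closure_coords:
  "weak_star_topology closure_of dual_span (range (coord e)) = dual"
proof (intro equalityI subsetI)
  show "f \<in> dual" if "f \<in> weak_star_topology closure_of dual_span (range (coord e))" for f
    using that closure_of_subset_topspace[of weak_star_topology]
    by (auto simp: weak_star_topology_def)
  fix f assume f: "f \<in> dual"
  define g where "g N = restrict (\<lambda>x. \<Sum>n<N. f (e n) * x n) V" for N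
  have g_keep: "g N x = f (keep {..<N} x)" if "x \<in> V" for N x
    using that dual_keep[OF f that, of "{..<N}"] by (simp add: g_def)
  have g_dual: "g N \<in> dual" for N
    unfolding dual_def
  proof (intro CollectI conjI ballI allI)
    show "g N \<in> extensional V" by (simp add: g_def)
    show "g N (x + y) = g N x + g N y" if "x \<in> V" "y \<in> V" for x y
      using that triangle by (simp add: g_def distrib_left sum.distrib)
    show "g N (pointwise_scale c x) = c * g N x" if "x \<in> V" for c x
      using that scaling
      by (simp add: g_def) (simp add: pointwise_scale_def sum_distrib_left mult.left_commute)
    obtain B where B: "\<And>y. y \<in> V \<Longrightarrow> norm (f y) \<le> B * nrm y"
      using f unfolding dual_def by blast
    have "norm (g N x) \<le> \<bar>B\<bar> * nrm x" if "x \<in> V" for x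
    proof -
      have "norm (g N x) \<le> B * nrm (keep {..<N} x)"
        using B keep_in_V that g_keep by simp
      also have "\<dots> \<le> \<bar>B\<bar> * nrm x"
        using nrm_keep_le[OF that] nrm_nonneg'[OF keep_in_V[OF that]] by (intro mult_mono) auto
      finally show ?thesis .
    qed
    then show "\<exists>B. \<forall>x\<in>V. norm (g N x) \<le> B * nrm x" by blast
  qed
  show "f \<in> weak_star_topology closure_of dual_span (range (coord e))"
  proof (rule limitin_imp_in_closure_of)
    show "limitin weak_star_topology g f sequentially"
      unfolding weak_star_topology_def limitin_subtopology limitin_componentwise
    proof (intro conjI ballI)
      show "f \<in> extensional V" using f by (simp add: dual_def)
      show "\<forall>\<^sub>F N in sequentially. g N \<in> topspace (product_topology (\<lambda>_. euclidean) V)"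
        by (simp add: g_def PiE_def)
      show "limitin euclidean (\<lambda>N. g N x) (f x) sequentially" if "x \<in> V" for x
        using dual_sums[OF f that] that by (simp add: g_def sums_def)
    qed (use f g_dual in auto)
    have "g N \<in> dual_span (range (coord e))" for N
    proof -
      have inj: "inj_on (coord e) S" for S
      proof (rule inj_onI)
        fix i j assume eq: "coord e i = coord e j"
        have "coord e i (e i) = coord e j (e i)" by (simp only: eq)
        then show "i = j" using e_in_V by (simp add: unit_seq_def split: if_splits)
      qed
      define c where "c h = f (e (inv_into UNIV (coord e) h))" for h
      have "g N = restrict (\<lambda>x. \<Sum>h\<in>coord e ` {..<N}. c h * h x) V"
        unfolding g_def
        by (rule restrict_ext) (simp add: sum.reindex[OF inj] c_def inv_into_f_f[OF inj])
      then show ?thesis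
        unfolding dual_span_def by (intro CollectI exI[of _ "coord e ` {..<N}"] exI[of _ c]) auto
    qed
    then show "\<forall>\<^sub>F N in sequentially. g N \<in> dual_span (range (coord e))" by simp
  qed simp
qed

lemma basis_e: "basis e"
  unfolding basis_def
proof (intro conjI closure_span_e weak_star_closure_coords)
  show "range e \<subseteq> V" using e_in_V by auto
  show "\<exists>!es. biorthogonal e es"
    using biorthogonal_coordinate biorthogonal_unique by blast
  have "nrm (e n) * dual_norm (coord e n) \<le> L" for n
  proof -
    have "nrm (e n) * dual_norm (coord e n) \<le> nrm (e n) * 1"
      using dual_norm_coord_le by (intro mult_left_mono) (auto simp: nrm_e)
    then show ?thesis using weight_le[of n] nrm_e[of n] by linarith
  qed
  then show "bdd_above (range (\<lambda>n. nrm (e n) * dual_norm (coord e n)))"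
    by (intro bdd_aboveI[of _ L]) auto
  have "1 \<le> (INF n. nrm (e n))"
    by (rule cINF_greatest) (auto simp: nrm_e weight_ge_1)
  then show "0 < (INF n. nrm (e n))" by simp
  show "bdd_above (range (\<lambda>n. nrm (e n)))"
    by (intro bdd_aboveI[of _ L]) (auto simp: nrm_e weight_le)
qed

lemma partial_proj_eq: "x \<in> V \<Longrightarrow> partial_proj e A x = (\<lambda>N. keep (A \<inter> {..<N}) x)"
  by (simp add: partial_proj_def sum_scale_e fun_eq_iff)

lemma proj_eq:
  assumes "x \<in> V" shows "proj e A x = keep A x"
proof (cases "finite A")
  case True
  then show ?thesis using assms by (simp add: proj_def sum_scale_e)
next
  case False
  then show ?thesis
    unfolding proj_def partial_proj_eq[OF assms] using limitin_keep[OF assms]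
    by (simp, intro the_equality) (auto intro: limitin_metric_unique)
qed

lemma unconditional_e: "unconditional e"
  unfolding unconditional_def
  using limitin_keep nrm_keep_le
  by (intro exI[of _ 1]) (auto simp: proj_converges_def partial_proj_eq proj_eq)

section \<open>Comparing greedy and arbitrary projections\<close>

text \<open>
  After cancelling \<open>A \<inter> \<Lambda>\<close>, the largest modulus \<open>t\<close> of a coefficient on \<open>A - \<Lambda>\<close> is a threshold below
  every coefficient on \<open>\<Lambda>\<close>. The ratio \<open>L\<close> of the cardinalities makes up for the ratio of the weights,
  and it only improves when the common part is removed, since \<open>L \<ge> 1\<close>.
\<close>

lemma greedy_residual_le:
  assumes x: "x \<in> V" and \<Lambda>: "greedy_set e x \<Lambda>" and A: "finite A"
    and card: "L * real (card A) \<le> real (card \<Lambda>)"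
  shows "nrm (x - keep \<Lambda> x) \<le> nrm (x - keep A x)"
proof -
  have fin: "finite \<Lambda>" and gr: "\<And>n k. n \<in> \<Lambda> \<Longrightarrow> k \<notin> \<Lambda> \<Longrightarrow> norm (x k) \<le> norm (x n)"
    using \<Lambda> x by (auto simp: greedy_set_def)
  let ?f = "\<lambda>n. w n * norm (x n)"
  have "sum ?f (A - \<Lambda>) \<le> sum ?f (\<Lambda> - A)"
  proof (cases "A - \<Lambda> = {}")
    case True
    have "0 \<le> sum ?f (\<Lambda> - A)" by (intro sum_nonneg) simp
    then show ?thesis unfolding True by simp
  next
    case False
    define t where "t = Max ((\<lambda>n. norm (x n)) ` (A - \<Lambda>))"
    have t_upper: "norm (x n) \<le> t" if "n \<in> A - \<Lambda>" for n
      unfolding t_def using that A by (intro Max_ge) auto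
    have "t \<in> (\<lambda>n. norm (x n)) ` (A - \<Lambda>)"
      unfolding t_def using A False by (intro Max_in) auto
    then obtain k where k: "k \<in> A - \<Lambda>" "t = norm (x k)" by blast
    have t_lower: "t \<le> norm (x n)" if "n \<in> \<Lambda>" for n
      using gr[OF that, of k] k by simp
    have t0: "0 \<le> t" using k by simp
    have "L * real (card (A - \<Lambda>)) \<le> real (card (\<Lambda> - A))"
    proof -
      have "card A = card (A - \<Lambda>) + card (A \<inter> \<Lambda>)"
        using A card_Diff_subset_Int[of A \<Lambda>] card_mono[of A "A \<inter> \<Lambda>"] by auto
      moreover have "card \<Lambda> = card (\<Lambda> - A) + card (A \<inter> \<Lambda>)"
        using fin card_Diff_subset_Int[of \<Lambda> A] card_mono[of \<Lambda> "\<Lambda> \<inter> A"] by (auto simp: Int_commute)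
      moreover have "1 * real (card (A \<inter> \<Lambda>)) \<le> L * real (card (A \<inter> \<Lambda>))"
        using L_ge_1 by (intro mult_right_mono) auto
      ultimately show ?thesis using card by (simp add: distrib_left)
    qed
    then have count: "L * real (card (A - \<Lambda>)) * t \<le> real (card (\<Lambda> - A)) * t"
      using t0 by (rule mult_right_mono)
    have "sum ?f (A - \<Lambda>) \<le> real (card (A - \<Lambda>)) * (L * t)"
      using t_upper L_ge_1 weight_le by (intro sum_bounded_above mult_mono) auto
    also have "\<dots> \<le> real (card (\<Lambda> - A)) * t"
      using count by (simp add: mult_ac)
    also have "\<dots> \<le> sum ?f (\<Lambda> - A)"
    proof (rule sum_bounded_below)
      fix n assume "n \<in> \<Lambda> - A"
      then have "1 * t \<le> ?f n"
        using t_lower t0 weight_ge_1 by (intro mult_mono) auto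
      then show "t \<le> ?f n" by simp
    qed
    finally show ?thesis .
  qed
  moreover have "sum ?f A = sum ?f (A - \<Lambda>) + sum ?f (A \<inter> \<Lambda>)"
    using sum.Int_Diff[OF A, of ?f \<Lambda>] by simp
  moreover have "sum ?f \<Lambda> = sum ?f (\<Lambda> - A) + sum ?f (A \<inter> \<Lambda>)"
    using sum.Int_Diff[OF fin, of ?f A] by (simp add: Int_commute)
  ultimately show ?thesis
    using nrm_keep_compl[OF x] A fin by simp
qed

lemma L_almost_greedy: "lambda_almost_greedy L e 1"
  unfolding lambda_almost_greedy_def
proof (intro ballI allI)
  fix x m assume x: "x \<in> V"
  let ?M = "nat \<lceil>L * real m\<rceil>"
  have M: "L * real m \<le> real ?M"
    by (rule real_nat_ceiling_ge)
  have "greedy_error e ?M x \<le> projection_error e m x"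
    unfolding greedy_error_def projection_error_def
  proof (rule cSup_least)
    \<comment> \<open>Both sets of residual norms must be nonempty, as \<open>Sup\<close> and \<open>Inf\<close> of the empty
      set of reals carry no information.\<close>
    show "{nrm (x - proj e \<Lambda> x) |\<Lambda>. greedy_set e x \<Lambda> \<and> card \<Lambda> = ?M} \<noteq> {}"
      using null_sequence_greedy_exists[OF null_sequence[OF x], of ?M] x
      by (auto simp: greedy_set_def)
    fix r assume "r \<in> {nrm (x - proj e \<Lambda> x) |\<Lambda>. greedy_set e x \<Lambda> \<and> card \<Lambda> = ?M}"
    then obtain \<Lambda> where r: "r = nrm (x - keep \<Lambda> x)" "greedy_set e x \<Lambda>" "card \<Lambda> = ?M"
      using proj_eq[OF x] by auto
    show "r \<le> Inf {nrm (x - proj e A x) |A. finite A \<and> card A = m}"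
    proof (rule cInf_greatest)
      show "{nrm (x - proj e A x) |A. finite A \<and> card A = m} \<noteq> {}"
        by (auto intro!: exI[of _ "{..<m}"])
      fix s assume "s \<in> {nrm (x - proj e A x) |A. finite A \<and> card A = m}"
      then obtain A where "s = nrm (x - keep A x)" "finite A" "card A = m"
        using proj_eq[OF x] by auto
      then show "r \<le> s"
        using greedy_residual_le[OF x r(2), of A] r M by simp
    qed
  qed
  then show "greedy_error e ?M x \<le> 1 * projection_error e m x" by simp
qed

text \<open>
  All nonzero coefficients of \<open>e i + e j\<close> tie, so a greedy set of one element may pick the lighter
  coordinate \<open>i\<close> and leave the residual norm \<open>w j\<close>, although deleting \<open>j\<close> would leave only \<open>w i\<close>.
\<close>

lemma not_almost_greedy:
  assumes "w i < w j"
  shows "\<not> almost_greedy e 1"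
proof
  assume ag: "almost_greedy e 1"
  have ij: "i \<noteq> j" using assms by auto
  define x where "x = e i + e j"
  have x: "x \<in> V" unfolding x_def by (intro triangle e_in_V)
  have xn: "x n = (if n \<in> {i, j} then 1 else 0)" for n
    using ij by (auto simp: x_def unit_seq_def)
  have "nrm x = w i + w j"
    using nrm_finite_support(2)[of "{i, j}" x] ij by (simp add: xn)
  then have residual: "nrm (x - keep {k} x) = w i + w j - w k" if "k \<in> {i, j}" for k
    using nrm_keep_compl[OF x, of "{k}"] that by (auto simp: xn)
  have "w j \<le> greedy_error e 1 x"
    unfolding greedy_error_def
  proof (rule cSup_upper)
    have "greedy_set e x {i}"
      using x by (auto simp: greedy_set_def xn)
    then show "w j \<in> {nrm (x - proj e \<Lambda> x) |\<Lambda>. greedy_set e x \<Lambda> \<and> card \<Lambda> = 1}"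
      using residual[of i] proj_eq[OF x] by (auto intro!: exI[of _ "{i}"])
    have "nrm (x - keep A x) \<le> nrm x" for A
      using V_of_dominated(2)[OF x, of "x - keep A x"] by (auto simp: keep_def)
    then show "bdd_above {nrm (x - proj e \<Lambda> x) |\<Lambda>. greedy_set e x \<Lambda> \<and> card \<Lambda> = 1}"
      by (intro bdd_aboveI[of _ "nrm x"]) (auto simp: proj_eq[OF x])
  qed
  also have "\<dots> \<le> projection_error e 1 x"
    using ag x by (auto simp: almost_greedy_def)
  also have "\<dots> \<le> w i"
    unfolding projection_error_def
  proof (rule cInf_lower)
    show "w i \<in> {nrm (x - proj e A x) |A. finite A \<and> card A = 1}"
      using residual[of j] proj_eq[OF x] by (auto intro!: exI[of _ "{j}"])
    show "bdd_below {nrm (x - proj e A x) |A. finite A \<and> card A = 1}"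
      by (intro bdd_belowI[of _ 0]) (auto simp: proj_eq[OF x] nrm_nonneg' diff_in_V keep_in_V x)
  qed
  finally show False using assms by simp
qed

lemma separates:
  assumes "w i < w j"
  shows "\<exists>(scale :: 'k \<Rightarrow> (nat \<Rightarrow> 'k) \<Rightarrow> (nat \<Rightarrow> 'k)) V nrm e.
      banach_space_on scale V nrm \<and>
      normed_space_on.infinite_dimensional scale V \<and>
      normed_space_on.basis scale V nrm e \<and>
      normed_space_on.unconditional scale V nrm e \<and>
      \<not> normed_space_on.almost_greedy scale V nrm e 1 \<and>
      (\<exists>lam>1. normed_space_on.lambda_almost_greedy scale V nrm lam e 1)"
proof (intro exI conjI)
  show "1 < L"
    using assms weight_ge_1[of i] weight_le[of j] by simp
qed (rule banach_space_on_axioms infinite_dimensional_V basis_e unconditional_e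
  not_almost_greedy[OF assms] L_almost_greedy)+

end

theorem theorem1p9:
  shows "(\<exists>(scale :: real \<Rightarrow> (nat \<Rightarrow> real) \<Rightarrow> (nat \<Rightarrow> real)) V nrm e.
      banach_space_on scale V nrm \<and>
      normed_space_on.infinite_dimensional scale V \<and>
      normed_space_on.basis scale V nrm e \<and>
      normed_space_on.unconditional scale V nrm e \<and>
      \<not> normed_space_on.almost_greedy scale V nrm e 1 \<and>
      (\<exists>lam>1. normed_space_on.lambda_almost_greedy scale V nrm lam e 1))
    \<and>
    (\<exists>(scale :: complex \<Rightarrow> (nat \<Rightarrow> complex) \<Rightarrow> (nat \<Rightarrow> complex)) V nrm e.
      banach_space_on scale V nrm \<and>
      normed_space_on.infinite_dimensional scale V \<and>
      normed_space_on.basis scale V nrm e \<and>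
      normed_space_on.unconditional scale V nrm e \<and>
      \<not> normed_space_on.almost_greedy scale V nrm e 1 \<and>
      (\<exists>lam>1. normed_space_on.lambda_almost_greedy scale V nrm lam e 1))"
proof -
  define w :: "nat \<Rightarrow> real" where "w n = (if n = 0 then 2 else 1)" for n
  have "w 1 < w 0" by (simp add: w_def)
  moreover have "weighted_l1 w 2" by unfold_locales (simp_all add: w_def)
  ultimately show ?thesis
    using weighted_l1.separates[where 'k = real] weighted_l1.separates[where 'k = complex] by blast
qed

end
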